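(* Let $\rho\in\mathcal{P}_+(G)$, let $\lambda_i=\lambda_i(\rho)>0$ and $u_i=u_i(\rho)$ ($i=1,\dots,n-1$) be the positive eigenvalues and corresponding orthonormal eigenvectors of $L(\rho)$, and let $X_i=\sqrt{\lambda_i}\,u_i$, $i=1,\dots,n-1$, a $g_W$-orthonormal basis of $T_\rho\mathcal{P}_+(G)$. Define $$\hat m(X_a,X_b):=-[\lambda_aL(X_a)X_b+\lambda_bL(X_b)X_a]+\tfrac12L(\rho)(\nabla_GX_a\circ\nabla_GX_b),\quad \hat n(X_a,X_b):=\lambda_aL(X_a)X_b-\lambda_bL(X_b)X_a.$$ Given $X_i,X_j,X_k,X_l$, the curvature tensor $R^W_{ijkl}=g_W(R^W(X_i,X_j)X_k,X_l)$ satisfies $$\begin{aligned}R^W_{ijkl}=\frac{1}{4\lambda_i\lambda_j\lambda_k\lambda_l}\Big\{&X_j^{\mathsf T}L(\hat m(X_i,X_k))X_l+X_i^{\mathsf T}L(\hat m(X_j,X_l))X_k-X_j^{\mathsf T}L(\hat m(X_i,X_l))X_k-X_i^{\mathsf T}L(\hat m(X_j,X_k))X_l\\&+2\hat n(X_i,X_j)^{\mathsf T}L(\rho)^\dagger\hat n(X_k,X_l)+\hat n(X_i,X_k)^{\mathsf T}L(\rho)^\dagger\hat n(X_j,X_l)-\hat n(X_j,X_k)^{\mathsf T}L(\rho)^\dagger\hat n(X_i,X_l)\Big\}.\end{aligned}$$ Thus: (i) the sectional curvature $K^W_{ij}=g_W(R^W(X_i,X_j)X_j,X_i)$ satisfies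 $$\begin{aligned}K^W_{ij}=\frac{1}{4\lambda_i^2\lambda_j^2}\Big\{&X_j^{\mathsf T}L(\hat m(X_i,X_j))X_i+X_i^{\mathsf T}L(\hat m(X_j,X_i))X_j-X_j^{\mathsf T}L(\hat m(X_i,X_i))X_j-X_i^{\mathsf T}L(\hat m(X_j,X_j))X_i\\&-3\hat n(X_i,X_j)^{\mathsf T}L(\rho)^\dagger\hat n(X_i,X_j)\Big\};\end{aligned}$$ (ii) the Ricci curvature $\mathrm{Ric}^W_{ij}=\sum_{k=1}^{n-1}g_W(R^W(X_i,X_k)X_k,X_j)$ satisfies $$\begin{aligned}\mathrm{Ric}^W_{ij}=\frac{1}{4\lambda_i\lambda_j}\sum_{k=1}^{n-1}\frac1{\lambda_k^2}\Big\{&X_k^{\mathsf T}L(\hat m(X_i,X_k))X_j+X_i^{\mathsf T}L(\hat m(X_j,X_k))X_k-X_k^{\mathsf T}L(\hat m(X_i,X_j))X_k-X_i^{\mathsf T}L(\hat m(X_k,X_k))X_j\\&-3\hat n(X_i,X_k)^{\mathsf T}L(\rho)^\dagger\hat n(X_j,X_k)\Big\};\end{aligned}$$ (iii) the scalar curvature $S^W=\sum_{i=1}^{n-1}\sum_{j=1}^{n-1}g_W(R^W(X_i,X_j)X_j,X_i)$ satisfies $$\begin{aligned}S^W=\sum_{i=1}^{n-1}\sum_{j=1}^{n-1}\frac{1}{4\lambda_i\lambda_j}\sum_{k=1}^{n-1}\frac1{\lambda_k^2}\Big\{&X_k^{\mathsf T}L(\hat m(X_i,X_k))X_j+X_i^{\mathsf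 T}L(\hat m(X_j,X_k))X_k-X_k^{\mathsf T}L(\hat m(X_i,X_j))X_k-X_i^{\mathsf T}L(\hat m(X_k,X_k))X_j\\&-3\hat n(X_i,X_k)^{\mathsf T}L(\rho)^\dagger\hat n(X_j,X_k)\Big\}.\end{aligned}$$
   Context: $G=(V,E,\omega)$ is a connected, weighted, undirected finite graph with vertex set $V=\{1,\dots,n\}$, edge set $E$ and weights $\omega_{ij}=\omega_{ji}>0$ if $(i,j)\in E$, $\omega_{ij}=0$ otherwise; $N(i)=\{j:(i,j)\in E\}$. For $\Phi\in\mathbb{R}^n$, $\nabla_G\Phi=(\nabla_{ij}\Phi)$ with $\nabla_{ij}\Phi=\sqrt{\omega_{ij}}(\Phi(i)-\Phi(j))$; for edge fields $v,\tilde v$, $v\circ\tilde v=\frac12\big(\sum_{j\in N(i)}v_{ij}\tilde v_{ij}\big)_{i=1}^n\in\mathbb{R}^n$. For $a\in\mathbb{R}^n$ put $\theta_{ij}(a)=\frac{a_i+a_j}{2}$; the linear weighted Laplacian matrix $L(a)\in\mathbb{R}^{n\times n}$ is the symmetric matrix given by $(L(a)\Phi)(i)=\sum_{j\in N(i)}\omega_{ij}\theta_{ij}(a)(\Phi(i)-\Phi(j))$. $A^\dagger$ is the Moore-Penrose pseudo-inverse. For $\rho\in\mathcal{P}_+(G)$, $L(\rho)$ is positive semidefinite with one-dimensional kernel spanned by $(1,\dots,1)^{\mathsf T}$. $\mathcal{P}_+(G)=\{\rho\in\mathbb{R}^n:\sum_i\rho_i=1,\ \rho_i>0\}$, with tangent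 space $T_\rho\mathcal{P}_+(G)=\{\sigma\in\mathbb{R}^n:\sum_i\sigma_i=0\}$, carries the Riemannian metric $g_W(\sigma_1,\sigma_2)=\sigma_1^{\mathsf T}L(\rho)^\dagger\sigma_2$, with Levi-Civita connection $\nabla^W$. Curvature convention: $R^W(\sigma_1,\sigma_2)\sigma_3=\nabla^W_{\sigma_1}\nabla^W_{\sigma_2}\sigma_3-\nabla^W_{\sigma_2}\nabla^W_{\sigma_1}\sigma_3-\nabla^W_{[\sigma_1,\sigma_2]}\sigma_3$, where in the computation tangent vectors $\sigma$ are extended as constant fields, so that the commutator term vanishes.
   Formalization: In (iii) the printed outer double sum over i and j, which adds all Ricci entries, is false in general for n ≥ 4; it is replaced by the single sum over i with j = i (the trace), matching the definition of the scalar curvature S. *)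

theory Defs
  imports "HOL-Analysis.Analysis"
begin

section \<open>Weighted graphs and the linear weighted Laplacian\<close>

definition weighted_graph :: "('n \<times> 'n) set \<Rightarrow> ('n \<Rightarrow> 'n \<Rightarrow> real) \<Rightarrow> bool" where
  "weighted_graph E \<omega> \<longleftrightarrow>
     sym E \<and>
     (\<forall>i j. \<omega> i j = \<omega> j i) \<and>
     (\<forall>i j. (i, j) \<in> E \<longrightarrow> \<omega> i j > 0) \<and>
     (\<forall>i j. (i, j) \<notin> E \<longrightarrow> \<omega> i j = 0)"

definition connected_graph :: "('n \<times> 'n) set \<Rightarrow> bool" where
  "connected_graph E \<longleftrightarrow> (\<forall>i j. (i, j) \<in> E\<^sup>*)"

definition nbrs :: "('n \<times> 'n) set \<Rightarrow> 'n \<Rightarrow> 'n set" where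
  "nbrs E i = {j. (i, j) \<in> E}"

definition grad :: "('n::finite \<Rightarrow> 'n \<Rightarrow> real) \<Rightarrow> real ^ 'n \<Rightarrow> 'n \<Rightarrow> 'n \<Rightarrow> real" where
  "grad \<omega> \<Phi> i j = sqrt (\<omega> i j) * (\<Phi> $ i - \<Phi> $ j)"

definition edge_prod ::
  "('n::finite \<times> 'n) set \<Rightarrow> ('n \<Rightarrow> 'n \<Rightarrow> real) \<Rightarrow> ('n \<Rightarrow> 'n \<Rightarrow> real) \<Rightarrow> real ^ 'n" where
  "edge_prod E v w = (1 / 2) *\<^sub>R (\<chi> i. \<Sum>j\<in>nbrs E i. v i j * w i j)"

definition theta :: "real ^ 'n::finite \<Rightarrow> 'n \<Rightarrow> 'n \<Rightarrow> real" where
  "theta a i j = (a $ i + a $ j) / 2"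

definition laplacian ::
  "('n::finite \<times> 'n) set \<Rightarrow> ('n \<Rightarrow> 'n \<Rightarrow> real) \<Rightarrow> real ^ 'n \<Rightarrow> real ^ 'n ^ 'n" where
  "laplacian E \<omega> a =
     matrix (\<lambda>\<Phi>. \<chi> i. \<Sum>j\<in>nbrs E i. \<omega> i j * theta a i j * (\<Phi> $ i - \<Phi> $ j))"

lemma laplacian_mult_vec:
  "laplacian E \<omega> a *v \<Phi> =
     (\<chi> i. \<Sum>j\<in>nbrs E i. \<omega> i j * theta a i j * (\<Phi> $ i - \<Phi> $ j))"
proof -
  have "linear (\<lambda>\<Phi>::real^'a. \<chi> i. \<Sum>j\<in>nbrs E i. \<omega> i j * theta a i j * (\<Phi> $ i - \<Phi> $ j))"
    by (rule linearI)
       (simp_all add: vec_eq_iff algebra_simps sum.distrib sum_subtractf sum_distrib_left)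
  then show ?thesis
    unfolding laplacian_def by (simp add: matrix_works)
qed

section \<open>Moore--Penrose pseudo-inverse\<close>

definition is_pseudo_inverse :: "real ^ 'n::finite ^ 'm::finite \<Rightarrow> real ^ 'm ^ 'n \<Rightarrow> bool" where
  "is_pseudo_inverse A B \<longleftrightarrow>
     A ** B ** A = A \<and> B ** A ** B = B \<and>
     transpose (A ** B) = A ** B \<and> transpose (B ** A) = B ** A"

definition pseudo_inverse :: "real ^ 'n::finite ^ 'm::finite \<Rightarrow> real ^ 'm ^ 'n" where
  "pseudo_inverse A = (THE B. is_pseudo_inverse A B)"

section \<open>The probability simplex as a Riemannian manifold\<close>

definition simplex_interior :: "(real ^ 'n::finite) set" where
  "simplex_interior = {\<rho>. (\<Sum>i\<in>UNIV. \<rho> $ i) = 1 \<and> (\<forall>i. \<rho> $ i > 0)}"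

definition tangent_space :: "(real ^ 'n::finite) set" where
  "tangent_space = {\<sigma>. (\<Sum>i\<in>UNIV. \<sigma> $ i) = 0}"

definition wasserstein_metric ::
  "('n::finite \<times> 'n) set \<Rightarrow> ('n \<Rightarrow> 'n \<Rightarrow> real) \<Rightarrow> real ^ 'n \<Rightarrow> real ^ 'n \<Rightarrow> real ^ 'n \<Rightarrow> real" where
  "wasserstein_metric E \<omega> \<rho> \<sigma>1 \<sigma>2 = \<sigma>1 \<bullet> (pseudo_inverse (laplacian E \<omega> \<rho>) *v \<sigma>2)"

text \<open>
  The simplex interior is a relatively open subset of an affine hyperplane of codimension one,
  so a Frechet derivative within it is not unique. Calculus on it is therefore phrased through
  directional derivatives along tangent vectors. Functions and fields are total on the ambient
  space, but only their values on the simplex interior enter the notions below.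
\<close>

definition dir_deriv ::
  "real ^ 'n::finite \<Rightarrow> (real ^ 'n \<Rightarrow> 'b::real_normed_vector) \<Rightarrow> real ^ 'n \<Rightarrow> 'b" where
  "dir_deriv \<sigma> f \<rho> = vector_derivative (\<lambda>t. f (\<rho> + t *\<^sub>R \<sigma>)) (at 0)"

primrec C_diff :: "nat \<Rightarrow> (real ^ 'n::finite \<Rightarrow> 'b::real_normed_vector) \<Rightarrow> bool" where
  "C_diff 0 f \<longleftrightarrow> continuous_on simplex_interior f"
| "C_diff (Suc k) f \<longleftrightarrow>
     continuous_on simplex_interior f \<and>
     (\<forall>\<sigma>\<in>tangent_space.
        (\<forall>\<rho>\<in>simplex_interior. (\<lambda>t::real. f (\<rho> + t *\<^sub>R \<sigma>)) differentiable (at 0)) \<and>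
        C_diff k (dir_deriv \<sigma> f))"

definition smooth_fun :: "(real ^ 'n::finite \<Rightarrow> 'b::real_normed_vector) \<Rightarrow> bool" where
  "smooth_fun f \<longleftrightarrow> (\<forall>k. C_diff k f)"

definition vector_fields :: "(real ^ 'n::finite \<Rightarrow> real ^ 'n) set" where
  "vector_fields = {X. smooth_fun X \<and> (\<forall>\<rho>\<in>simplex_interior. X \<rho> \<in> tangent_space)}"

definition lie_bracket ::
  "(real ^ 'n::finite \<Rightarrow> real ^ 'n) \<Rightarrow> (real ^ 'n \<Rightarrow> real ^ 'n) \<Rightarrow> real ^ 'n \<Rightarrow> real ^ 'n" where
  "lie_bracket X Y \<rho> = dir_deriv (X \<rho>) Y \<rho> - dir_deriv (Y \<rho>) X \<rho>"

definition affine_connection ::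
  "((real ^ 'n::finite \<Rightarrow> real ^ 'n) \<Rightarrow> (real ^ 'n \<Rightarrow> real ^ 'n) \<Rightarrow> real ^ 'n \<Rightarrow> real ^ 'n) \<Rightarrow> bool"
where
  "affine_connection D \<longleftrightarrow>
     (\<forall>X\<in>vector_fields. \<forall>Y\<in>vector_fields. D X Y \<in> vector_fields) \<and>
     (\<forall>X\<in>vector_fields. \<forall>X'\<in>vector_fields. \<forall>Y\<in>vector_fields. \<forall>\<rho>\<in>simplex_interior.
        D (\<lambda>r. X r + X' r) Y \<rho> = D X Y \<rho> + D X' Y \<rho>) \<and>
     (\<forall>f. smooth_fun f \<longrightarrow>
        (\<forall>X\<in>vector_fields. \<forall>Y\<in>vector_fields. \<forall>\<rho>\<in>simplex_interior.
           D (\<lambda>r. f r *\<^sub>R X r) Y \<rho> = f \<rho> *\<^sub>R D X Y \<rho>)) \<and>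
     (\<forall>X\<in>vector_fields. \<forall>Y\<in>vector_fields. \<forall>Y'\<in>vector_fields. \<forall>\<rho>\<in>simplex_interior.
        D X (\<lambda>r. Y r + Y' r) \<rho> = D X Y \<rho> + D X Y' \<rho>) \<and>
     (\<forall>f. smooth_fun f \<longrightarrow>
        (\<forall>X\<in>vector_fields. \<forall>Y\<in>vector_fields. \<forall>\<rho>\<in>simplex_interior.
           D X (\<lambda>r. f r *\<^sub>R Y r) \<rho> = dir_deriv (X \<rho>) f \<rho> *\<^sub>R Y \<rho> + f \<rho> *\<^sub>R D X Y \<rho>))"

definition torsion_free ::
  "((real ^ 'n::finite \<Rightarrow> real ^ 'n) \<Rightarrow> (real ^ 'n \<Rightarrow> real ^ 'n) \<Rightarrow> real ^ 'n \<Rightarrow> real ^ 'n) \<Rightarrow> bool"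
where
  "torsion_free D \<longleftrightarrow>
     (\<forall>X\<in>vector_fields. \<forall>Y\<in>vector_fields. \<forall>\<rho>\<in>simplex_interior.
        D X Y \<rho> - D Y X \<rho> = lie_bracket X Y \<rho>)"

definition metric_compatible ::
  "(real ^ 'n::finite \<Rightarrow> real ^ 'n \<Rightarrow> real ^ 'n \<Rightarrow> real) \<Rightarrow>
   ((real ^ 'n \<Rightarrow> real ^ 'n) \<Rightarrow> (real ^ 'n \<Rightarrow> real ^ 'n) \<Rightarrow> real ^ 'n \<Rightarrow> real ^ 'n) \<Rightarrow> bool"
where
  "metric_compatible g D \<longleftrightarrow>
     (\<forall>X\<in>vector_fields. \<forall>Y\<in>vector_fields. \<forall>Z\<in>vector_fields. \<forall>\<rho>\<in>simplex_interior.
        dir_deriv (X \<rho>) (\<lambda>r. g r (Y r) (Z r)) \<rho> =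
          g \<rho> (D X Y \<rho>) (Z \<rho>) + g \<rho> (Y \<rho>) (D X Z \<rho>))"

definition levi_civita ::
  "(real ^ 'n::finite \<Rightarrow> real ^ 'n \<Rightarrow> real ^ 'n \<Rightarrow> real) \<Rightarrow>
   ((real ^ 'n \<Rightarrow> real ^ 'n) \<Rightarrow> (real ^ 'n \<Rightarrow> real ^ 'n) \<Rightarrow> real ^ 'n \<Rightarrow> real ^ 'n) \<Rightarrow> bool"
where
  "levi_civita g D \<longleftrightarrow> affine_connection D \<and> torsion_free D \<and> metric_compatible g D"

definition curvature ::
  "((real ^ 'n::finite \<Rightarrow> real ^ 'n) \<Rightarrow> (real ^ 'n \<Rightarrow> real ^ 'n) \<Rightarrow> real ^ 'n \<Rightarrow> real ^ 'n) \<Rightarrow>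
   (real ^ 'n \<Rightarrow> real ^ 'n) \<Rightarrow> (real ^ 'n \<Rightarrow> real ^ 'n) \<Rightarrow> (real ^ 'n \<Rightarrow> real ^ 'n) \<Rightarrow>
   real ^ 'n \<Rightarrow> real ^ 'n" where
  "curvature D X Y Z \<rho> = D X (D Y Z) \<rho> - D Y (D X Z) \<rho> - D (lie_bracket X Y) Z \<rho>"

text \<open>
  Tangent vectors enter the curvature through their constant extensions; as the curvature is
  tensorial, the choice of extension does not affect the value at the base point.
\<close>

definition curvature_tensor ::
  "(real ^ 'n::finite \<Rightarrow> real ^ 'n \<Rightarrow> real ^ 'n \<Rightarrow> real) \<Rightarrow>
   ((real ^ 'n \<Rightarrow> real ^ 'n) \<Rightarrow> (real ^ 'n \<Rightarrow> real ^ 'n) \<Rightarrow> real ^ 'n \<Rightarrow> real ^ 'n) \<Rightarrow> real ^ 'n \<Rightarrow>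
   real ^ 'n \<Rightarrow> real ^ 'n \<Rightarrow> real ^ 'n \<Rightarrow> real ^ 'n \<Rightarrow> real" where
  "curvature_tensor g D \<rho> x y z w = g \<rho> (curvature D (\<lambda>_. x) (\<lambda>_. y) (\<lambda>_. z) \<rho>) w"

end

theory Submission
  imports Defs
begin

text \<open>
  Write \<open>\<Phi>\<^sub>x = L(r)\<^sup>\<dagger> x\<close> for the potential of a tangent vector \<open>x\<close>,
  \<open>A\<^sub>x\<^sub>y = L(x) \<Phi>\<^sub>y\<close>, \<open>G\<^sub>x\<^sub>y = \<nabla>\<Phi>\<^sub>x \<circ> \<nabla>\<Phi>\<^sub>y\<close> and
  \<open>\<langle>x, y\<rangle> = x\<^sup>T L(r)\<^sup>\<dagger> y\<close>.

  The Laplacian is linear in its weight vector and is dual to the product of gradients: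
  \<open>\<Phi>\<^sup>T L(a) \<Psi> = a\<^sup>T (\<nabla>\<Phi> \<circ> \<nabla>\<Psi>)\<close> (\<open>inner_laplacian\<close>). In particular \<open>L(a)\<close> is symmetric, and for
  positive weights on a connected graph it is positive definite on the tangent space
  (\<open>laplacian_inner_pos\<close>), so that there the pseudo-inverse is a genuine inverse. The resolvent
  identity (\<open>potential_difference\<close>) then gives the derivative of \<open>\<Phi>\<^sub>y\<close> in a tangent
  direction \<open>x\<close>: it is \<open>- L(r)\<^sup>\<dagger> L(x) \<Phi>\<^sub>y\<close> (\<open>potential_derivative\<close>).

  Constant fields commute, so Koszul's formula for them has only the three derivatives of the metric,
  and it identifies the covariant derivative of \<open>y\<close> along \<open>x\<close> as
  \<open>(L(r) G\<^sub>x\<^sub>y - A\<^sub>x\<^sub>y - A\<^sub>y\<^sub>x) / 2\<close> (\<open>connection_const\<close>). Its inner product with a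
  fixed tangent vector is a combination of energies \<open>\<Phi>\<^sup>T L(z) \<Psi>\<close>; differentiating these once more and
  using metric compatibility yields the second covariant derivatives
  (\<open>metric_second_covariant_derivative\<close>). Their antisymmetrisation is quadratic in the \<open>A\<close>
  and \<open>G\<close>. The terms containing \<open>G\<close> form the part with \<open>m\<close>: the factor one half in front of
  \<open>L(r) G\<close> there comes from sharing each term \<open>G\<^sup>T L(r) G\<close> between two summands. The terms with
  two factors \<open>A\<close> collapse to products of the antisymmetric combinations \<open>A\<^sub>x\<^sub>y - A\<^sub>y\<^sub>x\<close>, which is
  the part with \<open>n\<close> (\<open>curvature_tensor_potentials\<close>).

  On the eigenvector basis \<open>\<Phi>\<close> merely divides by the eigenvalue, and homogeneity turns
  this identity into the asserted formula. Sectional, Ricci and scalar curvature are contractions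
  of it; the coefficient \<open>-3\<close> is \<open>-2 - 1\<close>, obtained from the antisymmetry of \<open>n\<close>.
\<close>

section \<open>The Moore--Penrose pseudo-inverse\<close>

lemma transpose_eq_self_iff:
  fixes A :: "real ^ 'n ^ 'n"
  shows "transpose A = A \<longleftrightarrow> (\<forall>x y. (A *v x) \<bullet> y = x \<bullet> (A *v y))"
proof
  assume "transpose A = A"
  then show "\<forall>x y. (A *v x) \<bullet> y = x \<bullet> (A *v y)"
    by (metis dot_lmul_matrix transpose_matrix_vector)
next
  assume "\<forall>x y. (A *v x) \<bullet> y = x \<bullet> (A *v y)"
  then have "\<forall>x. transpose A *v x = A *v x"
    by (metis dot_lmul_matrix transpose_matrix_vector vector_eq_rdot)
  then show "transpose A = A"
    by (simp add: matrix_eq)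
qed

text \<open>
  The products \<open>A B\<close> and \<open>A C\<close> are both the orthogonal projection onto the range of \<open>A\<close>, and
  \<open>B A\<close> and \<open>C A\<close> both the one onto the orthogonal complement of its kernel; hence
  \<open>B = B A B = C A C = C\<close>.
\<close>

lemma is_pseudo_inverse_unique:
  fixes A :: "real ^ 'n::finite ^ 'm::finite"
  assumes B: "is_pseudo_inverse A B" and C: "is_pseudo_inverse A C"
  shows "B = C"
proof -
  have b: "A ** B ** A = A" "B ** A ** B = B" "transpose (A ** B) = A ** B" "transpose (B ** A) = B ** A"
    using B by (auto simp: is_pseudo_inverse_def)
  have c: "A ** C ** A = A" "C ** A ** C = C" "transpose (A ** C) = A ** C" "transpose (C ** A) = C ** A"
    using C by (auto simp: is_pseudo_inverse_def)
  have "A ** B = transpose ((A ** C) ** (A ** B))"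
    using b c by (simp add: matrix_mul_assoc)
  also have "\<dots> = A ** B ** A ** C"
    using b c by (simp only: matrix_transpose_mul) (simp add: matrix_mul_assoc)
  finally have AB: "A ** B = A ** C"
    using b by simp
  have "B ** A = transpose (B ** (A ** C ** A))"
    by (simp only: b c)
  also have "\<dots> = transpose ((B ** A) ** (C ** A))"
    by (simp only: matrix_mul_assoc)
  also have "\<dots> = (C ** A) ** (B ** A)"
    by (simp only: matrix_transpose_mul[of "B ** A"] b c)
  also have "\<dots> = C ** (A ** B ** A)"
    by (simp only: matrix_mul_assoc)
  finally have BA: "B ** A = C ** A"
    using b by simp
  have "B = B ** (A ** B)"
    using b by (simp add: matrix_mul_assoc)
  also have "\<dots> = C ** A ** C"
    by (simp add: AB matrix_mul_assoc BA)
  finally show ?thesis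
    using c by simp
qed

lemma pseudo_inverse_eqI: "is_pseudo_inverse A B \<Longrightarrow> pseudo_inverse A = B"
  unfolding pseudo_inverse_def by (blast intro: is_pseudo_inverse_unique)

section \<open>Calculus on the open simplex\<close>

lemma tangent_space_iff: "\<sigma> \<in> tangent_space \<longleftrightarrow> 1 \<bullet> \<sigma> = 0"
  by (simp add: tangent_space_def inner_vec_def)

lemma subspace_tangent_space: "subspace tangent_space"
  by (auto simp: subspace_def tangent_space_iff inner_add_right)

lemma dim_tangent_space: "dim (tangent_space :: (real ^ 'n::finite) set) = CARD('n) - 1"
proof -
  have "(tangent_space :: (real ^ 'n) set) = {x. 1 \<bullet> x = 0}"
    using tangent_space_iff by blast
  then show ?thesis
    using dim_hyperplane[of "1 :: real ^ 'n"] by simp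
qed

lemma eventually_in_simplex_interior:
  assumes "r \<in> simplex_interior" and "\<sigma> \<in> tangent_space"
  shows "\<forall>\<^sub>F t in nhds 0. r + t *\<^sub>R \<sigma> \<in> simplex_interior"
proof -
  have "\<forall>\<^sub>F t in nhds 0. \<forall>i. (r + t *\<^sub>R \<sigma>) $ i > 0"
  proof (rule eventually_all_finite)
    fix i
    have "((\<lambda>t. (r + t *\<^sub>R \<sigma>) $ i) \<longlongrightarrow> (r + 0 *\<^sub>R \<sigma>) $ i) (nhds 0)"
      by (intro tendsto_intros filterlim_ident)
    then show "\<forall>\<^sub>F t in nhds 0. (r + t *\<^sub>R \<sigma>) $ i > 0"
      using assms(1) by (intro order_tendstoD) (auto simp: simplex_interior_def)
  qed
  then show ?thesis
    by eventually_elim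
       (use assms in \<open>auto simp: simplex_interior_def tangent_space_def sum.distrib
          simp flip: sum_distrib_left\<close>)
qed

text \<open>
  Formulas that hold only inside the simplex suffice for computing directional derivatives, because
  a line through an interior point stays inside for small parameters.
\<close>

lemma dir_deriv_eqI:
  assumes "\<forall>\<^sub>F t in nhds 0. f (r + t *\<^sub>R \<sigma>) = h t"
    and "(h has_vector_derivative d) (at 0)"
  shows "dir_deriv \<sigma> f r = d"
proof -
  have "((\<lambda>t. f (r + t *\<^sub>R \<sigma>)) has_vector_derivative d) (at 0)"
    using assms(2) has_vector_derivative_cong_ev[where x = 0 and S = UNIV and g = h and f = "\<lambda>t. f (r + t *\<^sub>R \<sigma>)" and f' = d]
      assms(1) eventually_nhds_x_imp_x[OF assms(1)] by simp
  then show ?thesis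
    unfolding dir_deriv_def by (rule vector_derivative_at)
qed

lemma dir_deriv_const: "dir_deriv \<sigma> (\<lambda>_. c) = (\<lambda>_. 0)"
  by (simp add: dir_deriv_def fun_eq_iff)

lemma smooth_fun_const: "smooth_fun (\<lambda>_::real ^ 'n::finite. c)"
proof -
  have "C_diff k (\<lambda>_::real ^ 'n. c)" for k
    by (induction k arbitrary: c) (simp_all add: dir_deriv_const)
  then show ?thesis
    by (simp add: smooth_fun_def)
qed

lemma const_vector_field: "x \<in> tangent_space \<Longrightarrow> (\<lambda>_. x) \<in> vector_fields"
  by (simp add: vector_fields_def smooth_fun_const)

lemma lie_bracket_const: "lie_bracket (\<lambda>_. x) (\<lambda>_. y) = (\<lambda>_. 0)"
  by (simp add: lie_bracket_def dir_deriv_const fun_eq_iff)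

lemma affine_connection_zero_left:
  assumes D: "affine_connection D" and Y: "Y \<in> vector_fields" and r: "r \<in> simplex_interior"
  shows "D (\<lambda>_. 0) Y r = 0"
proof -
  have 0: "(\<lambda>_. 0) \<in> vector_fields"
    by (intro const_vector_field) (simp add: tangent_space_iff)
  have "\<forall>f. smooth_fun f \<longrightarrow> (\<forall>X\<in>vector_fields. \<forall>Y\<in>vector_fields. \<forall>r\<in>simplex_interior.
           D (\<lambda>r. f r *\<^sub>R X r) Y r = f r *\<^sub>R D X Y r)"
    using D by (simp add: affine_connection_def)
  from this[rule_format, OF smooth_fun_const 0 Y r, of 0] show ?thesis
    by simp
qed

section \<open>The weighted Laplacian\<close>

locale connected_weighted_graph =
  fixes E :: "('n::finite \<times> 'n) set" and \<omega> :: "'n \<Rightarrow> 'n \<Rightarrow> real"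
  assumes weighted: "weighted_graph E \<omega>" and connected: "connected_graph E"
begin

abbreviation L :: "real ^ 'n \<Rightarrow> real ^ 'n ^ 'n" where
  "L \<equiv> laplacian E \<omega>"

abbreviation P :: "real ^ 'n \<Rightarrow> real ^ 'n ^ 'n" where
  "P r \<equiv> pseudo_inverse (L r)"

definition grad_prod :: "real ^ 'n \<Rightarrow> real ^ 'n \<Rightarrow> real ^ 'n" where
  "grad_prod \<Phi> \<Psi> = edge_prod E (grad \<omega> \<Phi>) (grad \<omega> \<Psi>)"

lemma weight_sym: "\<omega> i j = \<omega> j i"
  and weight_nonneg: "\<omega> i j \<ge> 0"
  and weight_pos: "(i, j) \<in> E \<Longrightarrow> \<omega> i j > 0"
  and weight_zero: "(i, j) \<notin> E \<Longrightarrow> \<omega> i j = 0"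
proof -
  show "\<omega> i j = \<omega> j i" "(i, j) \<in> E \<Longrightarrow> \<omega> i j > 0" "(i, j) \<notin> E \<Longrightarrow> \<omega> i j = 0"
    using weighted unfolding weighted_graph_def by blast+
  then show "\<omega> i j \<ge> 0"
    by (cases "(i, j) \<in> E") auto
qed

text \<open>
  Weights vanish off the edge set, so sums over neighbours may run over all vertices; this removes
  the vertex-dependent index set before sums are interchanged.
\<close>

lemma sum_nbrs: "(\<Sum>j\<in>nbrs E i. \<omega> i j * f j) = (\<Sum>j\<in>UNIV. \<omega> i j * f j)"
  by (rule sum.mono_neutral_left) (auto simp: nbrs_def weight_zero)

lemma grad_prod_nth: "grad_prod \<Phi> \<Psi> $ i = (\<Sum>j\<in>UNIV. \<omega> i j * ((\<Phi> $ i - \<Phi> $ j) * (\<Psi> $ i - \<Psi> $ j))) / 2"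
proof -
  have "grad \<omega> \<Phi> i j * grad \<omega> \<Psi> i j = \<omega> i j * ((\<Phi> $ i - \<Phi> $ j) * (\<Psi> $ i - \<Psi> $ j))" for j
    using real_sqrt_mult_self[of "\<omega> i j"] weight_nonneg[of i j]
    by (simp add: grad_def algebra_simps)
  then show ?thesis
    by (simp add: grad_prod_def edge_prod_def sum_nbrs)
qed

lemma grad_prod_commute: "grad_prod \<Phi> \<Psi> = grad_prod \<Psi> \<Phi>"
  by (simp add: vec_eq_iff grad_prod_nth mult.commute)

lemma grad_prod_scaleR: "grad_prod (s *\<^sub>R \<Phi>) (t *\<^sub>R \<Psi>) = (s * t) *\<^sub>R grad_prod \<Phi> \<Psi>"
  by (simp add: vec_eq_iff grad_prod_nth algebra_simps sum_distrib_left)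

lemma laplacian_nth:
  "(L a *v \<Phi>) $ i = (\<Sum>j\<in>UNIV. \<omega> i j * (theta a i j * (\<Phi> $ i - \<Phi> $ j)))"
  by (simp add: laplacian_mult_vec sum_nbrs mult.assoc)

text \<open>
  Summation by parts. Both sides become the same double sum after symmetrising the summands in the
  two endpoints of an edge, since each side is then
  \<open>\<omega>\<^sub>i\<^sub>j (a\<^sub>i + a\<^sub>j) / 2\<close> times the product of the differences of \<open>\<Phi>\<close> and \<open>\<Psi>\<close>.
\<close>

lemma inner_laplacian: "\<Phi> \<bullet> (L a *v \<Psi>) = a \<bullet> grad_prod \<Phi> \<Psi>"
proof -
  let ?F = "\<lambda>i j. \<Phi> $ i * (\<omega> i j * (theta a i j * (\<Psi> $ i - \<Psi> $ j)))"
  let ?G = "\<lambda>i j. a $ i * (\<omega> i j * ((\<Phi> $ i - \<Phi> $ j) * (\<Psi> $ i - \<Psi> $ j))) / 2"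
  have double: "2 * (\<Sum>i\<in>UNIV. \<Sum>j\<in>UNIV. f i j) = (\<Sum>i\<in>UNIV. \<Sum>j\<in>UNIV. f i j + f j i)"
    for f :: "'n \<Rightarrow> 'n \<Rightarrow> real"
    using sum.swap[of f UNIV UNIV] by (simp add: sum.distrib)
  have FG: "?F i j + ?F j i = ?G i j + ?G j i" for i j
    unfolding weight_sym[of j i] theta_def by (simp add: field_simps)
  have "2 * (\<Phi> \<bullet> (L a *v \<Psi>)) = 2 * (\<Sum>i\<in>UNIV. \<Sum>j\<in>UNIV. ?F i j)"
    by (simp add: inner_vec_def laplacian_nth sum_distrib_left)
  also have "\<dots> = 2 * (\<Sum>i\<in>UNIV. \<Sum>j\<in>UNIV. ?G i j)"
    unfolding double FG ..
  also have "\<dots> = 2 * (a \<bullet> grad_prod \<Phi> \<Psi>)"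
    by (simp add: inner_vec_def grad_prod_nth sum_distrib_left sum_divide_distrib)
  finally show ?thesis
    by simp
qed

lemma laplacian_self_adjoint: "(L a *v \<Phi>) \<bullet> \<Psi> = \<Phi> \<bullet> (L a *v \<Psi>)"
  by (metis inner_laplacian inner_commute grad_prod_commute)

lemma laplacian_add_scaleR: "L (a + t *\<^sub>R b) *v \<Phi> = L a *v \<Phi> + t *\<^sub>R (L b *v \<Phi>)"
  by (simp add: vec_eq_iff laplacian_nth theta_def algebra_simps add_divide_distrib sum.distrib
        sum_distrib_left)

lemma laplacian_scaleR: "L (t *\<^sub>R b) *v \<Phi> = t *\<^sub>R (L b *v \<Phi>)"
  by (simp add: vec_eq_iff laplacian_nth theta_def algebra_simps add_divide_distrib sum_distrib_left)

lemma laplacian_one: "L a *v 1 = 0"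
  by (simp add: vec_eq_iff laplacian_nth)

lemma laplacian_tangent: "L a *v \<Phi> \<in> tangent_space"
  by (metis tangent_space_iff laplacian_self_adjoint laplacian_one inner_zero_left)

text \<open>
  A vanishing energy forces \<open>x\<close> to agree across every edge, hence to be constant by
  connectedness; a constant vector with zero sum is zero.
\<close>

lemma laplacian_inner_pos:
  assumes r: "r \<in> simplex_interior" and x: "x \<in> tangent_space" "x \<noteq> 0"
  shows "x \<bullet> (L r *v x) > 0"
proof -
  have r0: "r $ i > 0" for i
    using r by (simp add: simplex_interior_def)
  have G0: "grad_prod x x $ i \<ge> 0" for i
    unfolding grad_prod_nth by (intro divide_nonneg_pos sum_nonneg mult_nonneg_nonneg[OF weight_nonneg] zero_le_square) simp
  have "r \<bullet> grad_prod x x \<noteq> 0"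
  proof
    assume "r \<bullet> grad_prod x x = 0"
    then have "(\<Sum>i\<in>UNIV. r $ i * grad_prod x x $ i) = 0"
      by (simp add: inner_vec_def)
    then have "grad_prod x x $ i = 0" for i
      using r0 G0 by (subst (asm) sum_nonneg_eq_0_iff) (auto intro!: mult_nonneg_nonneg simp: less_imp_le less_imp_neq[THEN not_sym])
    then have *: "\<omega> i j * ((x $ i - x $ j) * (x $ i - x $ j)) = 0" for i j
      unfolding grad_prod_nth
      by (subst (asm) divide_eq_0_iff, subst (asm) sum_nonneg_eq_0_iff) (auto simp: weight_nonneg)
    have edge: "x $ i = x $ j" if "(i, j) \<in> E" for i j
      using *[of i j] weight_pos[OF that] by simp
    have eq: "x $ i = x $ j" for i j
    proof -
      have "(i, j) \<in> E\<^sup>*"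
        using connected by (simp add: connected_graph_def)
      then show ?thesis
        by induction (auto dest: edge)
    qed
    have "(\<Sum>j\<in>UNIV. x $ j) = (\<Sum>j\<in>(UNIV::'n set). x $ i)" for i
      by (rule sum.cong) (auto intro: eq)
    then have "x $ i = 0" for i
      using x(1) by (simp add: tangent_space_def)
    then show False
      using x(2) by (simp add: vec_eq_iff)
  qed
  moreover have "r \<bullet> grad_prod x x \<ge> 0"
    unfolding inner_vec_def using r0 G0 by (auto intro!: sum_nonneg mult_nonneg_nonneg simp: less_imp_le)
  ultimately show ?thesis
    by (simp add: inner_laplacian)
qed

text \<open>
  Adding the all-ones matrix \<open>J\<close> makes \<open>L(r)\<close> invertible without changing it on the tangent space.
  As \<open>J\<close> acts on the line of constant vectors as multiplication by the number \<open>n\<close> of vertices, the inverse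
  exceeds the pseudo-inverse exactly by \<open>J / n\<^sup>2\<close>, and both products of \<open>L(r)\<close> with the pseudo-inverse
  are the orthogonal projection onto the tangent space.
\<close>

lemma pseudo_inverse_laplacian:
  assumes r: "r \<in> simplex_interior"
  shows laplacian_pseudo_inverse: "x \<in> tangent_space \<Longrightarrow> L r *v (P r *v x) = x"
    and pseudo_inverse_laplacian_id: "x \<in> tangent_space \<Longrightarrow> P r *v (L r *v x) = x"
    and pseudo_inverse_self_adjoint: "(P r *v x) \<bullet> y = x \<bullet> (P r *v y)"
    and pseudo_inverse_tangent: "P r *v x \<in> tangent_space"
proof -
  define n where "n = real CARD('n)"
  have n0: "n > 0"
    by (simp add: n_def)
  have one: "(1::real^'n) \<bullet> 1 = n"
    by (simp add: inner_vec_def n_def)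
  define J :: "real^'n^'n" where "J = (\<chi> i j. 1)"
  have J: "J *v x = (1 \<bullet> x) *\<^sub>R 1" for x
    by (simp add: J_def vec_eq_iff matrix_vector_mult_def inner_vec_def)
  define M where "M = L r + J"
  have M: "M *v x = L r *v x + (1 \<bullet> x) *\<^sub>R 1" for x
    by (simp add: M_def J matrix_vector_mult_add_rdistrib)
  have Lt: "1 \<bullet> (L r *v x) = 0" for x
    using laplacian_tangent tangent_space_iff by blast
  have "x = 0" if "M *v x = 0" for x
  proof -
    have "1 \<bullet> (M *v x) = (1 \<bullet> x) * n"
      by (simp add: M inner_add_right Lt one)
    then have "1 \<bullet> x = 0"
      using that n0 by simp
    then show "x = 0"
      using that laplacian_inner_pos[OF r, of x] by (auto simp: M tangent_space_iff)
  qed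
  then have "invertible M"
    by (simp add: invertible_left_inverse matrix_left_invertible_ker)
  then obtain N where MN: "M ** N = mat 1" and NM: "N ** M = mat 1"
    by (auto simp: invertible_def)
  have MN': "M *v (N *v x) = x" and NM': "N *v (M *v x) = x" for x
    by (simp_all add: matrix_vector_mul_assoc MN NM)
  have M_sym: "(M *v x) \<bullet> y = x \<bullet> (M *v y)" for x y
    by (simp add: M inner_add_left inner_add_right laplacian_self_adjoint inner_commute[of x 1])
  have N_sym: "(N *v x) \<bullet> y = x \<bullet> (N *v y)" for x y
    by (metis M_sym MN')
  have "M *v 1 = n *\<^sub>R 1"
    by (simp add: M laplacian_one one)
  then have "N *v (n *\<^sub>R 1) = 1"
    by (metis NM')
  then have N1: "N *v 1 = (1 / n) *\<^sub>R 1"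
    using n0 by (simp add: matrix_vector_mult_scaleR) (metis divideR_right less_numeral_extra(3) divide_inverse mult_1)
  \<comment> \<open>The correction cancels \<open>N 1 = 1 / n\<close>, so that \<open>B\<close> annihilates constant vectors.\<close>
  define B where "B = N - (1 / n\<^sup>2) *\<^sub>R J"
  have B: "B *v x = N *v x - ((1 \<bullet> x) / n\<^sup>2) *\<^sub>R 1" for x
    by (simp add: B_def matrix_vector_mult_diff_rdistrib scaleR_matrix_vector_assoc[symmetric] J)
  have oneN: "1 \<bullet> (N *v x) = (1 \<bullet> x) / n" for x
    by (metis N_sym N1 inner_scaleR_left times_divide_eq_left mult_1)
  have LB: "L r *v (B *v x) = x - ((1 \<bullet> x) / n) *\<^sub>R 1" for x
  proof -
    have "L r *v (B *v x) = L r *v (N *v x)"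
      by (simp add: B matrix_vector_mult_diff_distrib matrix_vector_mult_scaleR laplacian_one)
    also have "\<dots> = M *v (N *v x) - (1 \<bullet> (N *v x)) *\<^sub>R 1"
      by (simp add: M)
    finally show ?thesis
      by (simp add: MN' oneN)
  qed
  have BL: "B *v (L r *v x) = x - ((1 \<bullet> x) / n) *\<^sub>R 1" for x
  proof -
    have "B *v (L r *v x) = N *v (M *v x - (1 \<bullet> x) *\<^sub>R 1)"
      by (simp add: B Lt M)
    then show ?thesis
      by (simp only: matrix_vector_mult_diff_distrib matrix_vector_mult_scaleR NM' N1) simp
  qed
  have B_tan: "1 \<bullet> (B *v x) = 0" for x
    using n0 by (simp add: B inner_diff_right oneN one power2_eq_square)
  have B1: "B *v 1 = 0"
    using n0 by (simp add: B N1 one power2_eq_square)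
  have "is_pseudo_inverse (L r) B"
    unfolding is_pseudo_inverse_def
  proof (intro conjI)
    show "L r ** B ** L r = L r" "B ** L r ** B = B"
      unfolding matrix_eq matrix_vector_mul_assoc[symmetric] LB BL by (auto simp: LB BL Lt B_tan matrix_vector_mult_diff_distrib matrix_vector_mult_scaleR laplacian_one B1)
    show "transpose (L r ** B) = L r ** B" "transpose (B ** L r) = B ** L r"
      unfolding transpose_eq_self_iff matrix_vector_mul_assoc[symmetric] LB BL
      by (simp_all add: inner_diff_left inner_diff_right inner_commute[of _ 1])
  qed
  then have PB: "P r = B"
    by (rule pseudo_inverse_eqI)
  show "x \<in> tangent_space \<Longrightarrow> L r *v (P r *v x) = x" "x \<in> tangent_space \<Longrightarrow> P r *v (L r *v x) = x"
    "P r *v x \<in> tangent_space"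
    by (simp_all add: PB LB BL tangent_space_iff B_tan)
  show "(P r *v x) \<bullet> y = x \<bullet> (P r *v y)"
    by (simp add: PB B inner_diff_left inner_diff_right N_sym inner_commute[of x 1])
qed

section \<open>Differentiating the pseudo-inverse along a line\<close>

text \<open>
  The lower bound of \<open>L(r)\<close> on the tangent space survives small perturbations: as long as the
  perturbation costs at most half of it, the inverses stay bounded by twice the original bound.
\<close>

lemma potential_bounded:
  assumes r: "r \<in> simplex_interior" and \<sigma>: "\<sigma> \<in> tangent_space"
  obtains C where "\<forall>\<^sub>F t in nhds 0. \<forall>v\<in>tangent_space. norm (P (r + t *\<^sub>R \<sigma>) *v v) \<le> C * norm v"
proof -
  have "\<exists>e>0. \<forall>x\<in>tangent_space. norm (L r *v x) \<ge> e * norm x"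
  proof (rule injective_imp_isometric)
    show "\<forall>x\<in>tangent_space. L r *v x = 0 \<longrightarrow> x = 0"
      using laplacian_inner_pos[OF r] by force
  qed (auto simp: closed_subspace subspace_tangent_space intro: matrix_vector_mul_bounded_linear)
  then obtain e where e: "e > 0" "\<And>x. x \<in> tangent_space \<Longrightarrow> norm (L r *v x) \<ge> e * norm x"
    by blast
  obtain K where K: "K > 0" "\<And>x. norm (L \<sigma> *v x) \<le> norm x * K"
    using bounded_linear.pos_bounded[OF matrix_vector_mul_bounded_linear[of "L \<sigma>"]] by blast
  \<comment> \<open>For these \<open>t\<close> the perturbation \<open>t L(\<sigma>)\<close> has norm at most \<open>e / 2\<close>.\<close>
  have "\<forall>\<^sub>F t in nhds 0. \<bar>t\<bar> < e / (2 * K)"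
    using e K by (auto simp: eventually_nhds_metric dist_real_def intro!: exI[of _ "e / (2 * K)"])
  with eventually_in_simplex_interior[OF r \<sigma>]
  have "\<forall>\<^sub>F t in nhds 0. \<forall>v\<in>tangent_space. norm (P (r + t *\<^sub>R \<sigma>) *v v) \<le> (2 / e) * norm v"
  proof eventually_elim
    case (elim t)
    show ?case
    proof
      fix v :: "real ^ 'n"
      assume v: "v \<in> tangent_space"
      define x where "x = P (r + t *\<^sub>R \<sigma>) *v v"
      have x: "x \<in> tangent_space"
        unfolding x_def by (rule pseudo_inverse_tangent[OF elim(1)])
      have "v = L r *v x + t *\<^sub>R (L \<sigma> *v x)"
        by (metis laplacian_add_scaleR laplacian_pseudo_inverse[OF elim(1) v] x_def)
      then have "norm (L r *v x) - norm (t *\<^sub>R (L \<sigma> *v x)) \<le> norm v"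
        using norm_diff_ineq by metis
      moreover have "norm (t *\<^sub>R (L \<sigma> *v x)) \<le> (e / (2 * K)) * (norm x * K)"
        unfolding norm_scaleR by (rule mult_mono) (use elim(2) K in auto)
      moreover have "(e / (2 * K)) * (norm x * K) = e * norm x / 2"
        using K(1) by simp
      ultimately have "e * norm x / 2 \<le> norm v"
        using e(2)[OF x] by linarith
      then show "norm x \<le> (2 / e) * norm v"
        using e(1) by (simp add: field_simps)
    qed
  qed
  then show ?thesis
    by (rule that)
qed

text \<open>
  The resolvent identity: the exact difference quotient of a potential is, up to sign, a potential at the
  displaced point, so that
  boundedness gives continuity, and continuity gives differentiability.
\<close>

lemma potential_difference:
  assumes r: "r \<in> simplex_interior" "r + t *\<^sub>R \<sigma> \<in> simplex_interior"
    and \<tau>: "\<tau> \<in> tangent_space"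
  shows "P (r + t *\<^sub>R \<sigma>) *v \<tau> - P r *v \<tau> = - t *\<^sub>R (P (r + t *\<^sub>R \<sigma>) *v (L \<sigma> *v (P r *v \<tau>)))"
proof -
  let ?x = "P r *v \<tau>"
  have "?x = P (r + t *\<^sub>R \<sigma>) *v (L (r + t *\<^sub>R \<sigma>) *v ?x)"
    by (simp add: pseudo_inverse_laplacian_id[OF r(2)] pseudo_inverse_tangent[OF r(1)])
  also have "\<dots> = P (r + t *\<^sub>R \<sigma>) *v (\<tau> + t *\<^sub>R (L \<sigma> *v ?x))"
    by (simp only: laplacian_add_scaleR laplacian_pseudo_inverse[OF r(1) \<tau>])
  also have "\<dots> = P (r + t *\<^sub>R \<sigma>) *v \<tau> + t *\<^sub>R (P (r + t *\<^sub>R \<sigma>) *v (L \<sigma> *v ?x))"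
    by (simp only: matrix_vector_right_distrib matrix_vector_mult_scaleR)
  finally show ?thesis
    by (simp add: algebra_simps)
qed

lemma potential_tendsto:
  assumes r: "r \<in> simplex_interior" and \<sigma>: "\<sigma> \<in> tangent_space" and \<tau>: "\<tau> \<in> tangent_space"
  shows "((\<lambda>t. P (r + t *\<^sub>R \<sigma>) *v \<tau>) \<longlongrightarrow> P r *v \<tau>) (nhds 0)"
proof -
  let ?v = "L \<sigma> *v (P r *v \<tau>)"
  obtain C where C: "\<forall>\<^sub>F t in nhds 0. \<forall>v\<in>tangent_space. norm (P (r + t *\<^sub>R \<sigma>) *v v) \<le> C * norm v"
    by (rule potential_bounded[OF r \<sigma>])
  have "((\<lambda>t. P (r + t *\<^sub>R \<sigma>) *v \<tau> - P r *v \<tau>) \<longlongrightarrow> 0) (nhds 0)"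
  proof (rule Lim_null_comparison)
    show "\<forall>\<^sub>F t in nhds 0. norm (P (r + t *\<^sub>R \<sigma>) *v \<tau> - P r *v \<tau>) \<le> \<bar>t\<bar> * (C * norm ?v)"
      using C eventually_in_simplex_interior[OF r \<sigma>]
    proof eventually_elim
      case (elim t)
      then show ?case
        using laplacian_tangent
        by (simp add: potential_difference[OF r elim(2) \<tau>] mult_left_mono)
    qed
    have "((\<lambda>t. \<bar>t\<bar> * (C * norm ?v)) \<longlongrightarrow> \<bar>0\<bar> * (C * norm ?v)) (nhds 0)"
      by (intro tendsto_intros filterlim_ident)
    then show "((\<lambda>t. \<bar>t\<bar> * (C * norm ?v)) \<longlongrightarrow> 0) (nhds 0)"
      by simp
  qed
  then show ?thesis
    by (simp add: LIM_zero_iff)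
qed

lemma potential_derivative:
  assumes r: "r \<in> simplex_interior" and \<sigma>: "\<sigma> \<in> tangent_space" and \<tau>: "\<tau> \<in> tangent_space"
  shows "((\<lambda>t. P (r + t *\<^sub>R \<sigma>) *v \<tau>) has_vector_derivative
           - (P r *v (L \<sigma> *v (P r *v \<tau>)))) (at 0)"
proof -
  let ?v = "L \<sigma> *v (P r *v \<tau>)"
  let ?p = "\<lambda>t v. P (r + t *\<^sub>R \<sigma>) *v v"
  have "((\<lambda>t. norm (?p t ?v - P r *v ?v)) \<longlongrightarrow> 0) (at 0)"
    by (rule tendsto_norm_zero, rule LIM_zero, rule filterlim_mono[OF potential_tendsto[OF r \<sigma> laplacian_tangent] order_refl])
       (simp add: at_within_def)
  moreover have "\<forall>\<^sub>F t in at 0. norm (?p t ?v - P r *v ?v)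
      = norm (?p (0 + t) \<tau> - ?p 0 \<tau> - t *\<^sub>R (- (P r *v ?v))) / norm t"
    using eventually_in_simplex_interior[OF r \<sigma>] unfolding eventually_at_filter
  proof eventually_elim
    case (elim t)
    have *: "?p (0 + t) \<tau> - ?p 0 \<tau> - t *\<^sub>R (- (P r *v ?v)) = - t *\<^sub>R (?p t ?v - P r *v ?v)"
      using potential_difference[OF r elim \<tau>] by (simp add: algebra_simps)
    show ?case
      unfolding * by simp
  qed
  ultimately have "((\<lambda>t. norm (?p (0 + t) \<tau> - ?p 0 \<tau> - t *\<^sub>R (- (P r *v ?v))) / norm t) \<longlongrightarrow> 0) (at 0)"
    by (rule Lim_transform_eventually)
  then show ?thesis
    unfolding has_vector_derivative_def has_derivative_at
    by (simp add: bounded_linear_scaleR_left bounded_linear_minus)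
qed

lemma energy_derivative:
  assumes r: "r \<in> simplex_interior" and \<sigma>: "\<sigma> \<in> tangent_space"
    and a: "a \<in> tangent_space" and b: "b \<in> tangent_space"
  shows "((\<lambda>t. (P (r + t *\<^sub>R \<sigma>) *v a) \<bullet> (L c *v (P (r + t *\<^sub>R \<sigma>) *v b))) has_vector_derivative
      - ((L \<sigma> *v (P r *v a)) \<bullet> (P r *v (L c *v (P r *v b))))
      - ((L c *v (P r *v a)) \<bullet> (P r *v (L \<sigma> *v (P r *v b))))) (at 0)"
proof -
  note d = potential_derivative[OF r \<sigma>, unfolded has_vector_derivative_def]
  have "((\<lambda>t. (P (r + t *\<^sub>R \<sigma>) *v a) \<bullet> (L c *v (P (r + t *\<^sub>R \<sigma>) *v b))) has_derivative
     (\<lambda>h. (P (r + 0 *\<^sub>R \<sigma>) *v a) \<bullet> (L c *v (h *\<^sub>R - (P r *v (L \<sigma> *v (P r *v b)))))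
        + (h *\<^sub>R - (P r *v (L \<sigma> *v (P r *v a)))) \<bullet> (L c *v (P (r + 0 *\<^sub>R \<sigma>) *v b)))) (at 0)"
    by (rule has_derivative_inner[OF d[OF a] bounded_linear.has_derivative[OF matrix_vector_mul_bounded_linear d[OF b]]])
  then show ?thesis
    unfolding has_vector_derivative_def
    by (rule has_derivative_eq_rhs)
      (simp add: fun_eq_iff matrix_vector_mult_scaleR algebra_simps pseudo_inverse_self_adjoint[OF r]
       laplacian_self_adjoint linear_neg[OF matrix_vector_mul_linear])
qed

lemma metric_derivative:
  assumes r: "r \<in> simplex_interior" and \<sigma>: "\<sigma> \<in> tangent_space"
    and a: "a \<in> tangent_space" and b: "b \<in> tangent_space"
  shows "dir_deriv \<sigma> (\<lambda>r. wasserstein_metric E \<omega> r a b) r = - ((P r *v a) \<bullet> (L \<sigma> *v (P r *v b)))"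
proof (rule dir_deriv_eqI)
  have "((\<lambda>t. a \<bullet> (P (r + t *\<^sub>R \<sigma>) *v b)) has_vector_derivative
      a \<bullet> (- (P r *v (L \<sigma> *v (P r *v b))))) (at 0)"
    by (rule bounded_linear.has_vector_derivative[OF bounded_linear_inner_right potential_derivative[OF r \<sigma> b]])
  then show "((\<lambda>t. a \<bullet> (P (r + t *\<^sub>R \<sigma>) *v b)) has_vector_derivative
      - ((P r *v a) \<bullet> (L \<sigma> *v (P r *v b)))) (at 0)"
    by (simp add: pseudo_inverse_self_adjoint[OF r])
qed (simp add: wasserstein_metric_def)

section \<open>The Levi-Civita connection on constant fields\<close>

definition christoffel :: "real ^ 'n \<Rightarrow> real ^ 'n \<Rightarrow> real ^ 'n \<Rightarrow> real ^ 'n" where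
  "christoffel r a b = (1 / 2) *\<^sub>R (L r *v grad_prod (P r *v a) (P r *v b) - L a *v (P r *v b) - L b *v (P r *v a))"

lemma christoffel_tangent: "christoffel r a b \<in> tangent_space"
  unfolding christoffel_def
  by (intro subspace_scale subspace_diff subspace_tangent_space laplacian_tangent)

lemma metric_laplacian:
  assumes "r \<in> simplex_interior" "c \<in> tangent_space"
  shows "(L r *v x) \<bullet> (P r *v c) = x \<bullet> c"
  using assms by (simp add: laplacian_self_adjoint laplacian_pseudo_inverse)

lemma metric_christoffel:
  assumes r: "r \<in> simplex_interior" and c: "c \<in> tangent_space"
  shows "2 * wasserstein_metric E \<omega> r (christoffel r a b) c =
     (P r *v a) \<bullet> (L c *v (P r *v b)) - (P r *v b) \<bullet> (L a *v (P r *v c))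
     - (P r *v a) \<bullet> (L b *v (P r *v c))"
  by (simp add: wasserstein_metric_def christoffel_def inner_diff_left metric_laplacian[OF r c]
        inner_commute[of _ c] inner_laplacian[symmetric])
     (simp add: laplacian_self_adjoint)

text \<open>
  With \<open>c = x - y\<close>, the hypothesis says that the potential of \<open>c\<close> has zero energy, so
  that this potential, and \<open>c\<close> with it, vanishes.
\<close>

lemma metric_nondegenerate:
  assumes r: "r \<in> simplex_interior" and x: "x \<in> tangent_space" and y: "y \<in> tangent_space"
    and eq: "\<And>c. c \<in> tangent_space \<Longrightarrow> wasserstein_metric E \<omega> r x c = wasserstein_metric E \<omega> r y c"
  shows "x = y"
proof -
  let ?c = "x - y"
  have c: "?c \<in> tangent_space"
    using x y by (simp add: subspace_diff subspace_tangent_space)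
  have "?c \<bullet> (P r *v ?c) = 0"
    using eq[OF c] by (simp add: wasserstein_metric_def inner_diff_left)
  then have "(P r *v ?c) \<bullet> (L r *v (P r *v ?c)) = 0"
    by (simp only: laplacian_pseudo_inverse[OF r c] inner_commute)
  then have "P r *v ?c = 0"
    using laplacian_inner_pos[OF r pseudo_inverse_tangent[OF r]] by force
  then have "?c = 0"
    by (metis laplacian_pseudo_inverse[OF r c] matrix_vector_mult_0_right)
  then show ?thesis
    by simp
qed

context
  fixes D
  assumes lc: "levi_civita (wasserstein_metric E \<omega>) D"
begin

lemma connection_field: "X \<in> vector_fields \<Longrightarrow> Y \<in> vector_fields \<Longrightarrow> D X Y \<in> vector_fields"
  using lc by (auto simp: levi_civita_def affine_connection_def)

lemma connection_compatible:
  assumes "X \<in> vector_fields" "Y \<in> vector_fields" "Z \<in> vector_fields" "r \<in> simplex_interior"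
  shows "dir_deriv (X r) (\<lambda>r. wasserstein_metric E \<omega> r (Y r) (Z r)) r =
    wasserstein_metric E \<omega> r (D X Y r) (Z r) + wasserstein_metric E \<omega> r (Y r) (D X Z r)"
  using lc assms by (auto simp: levi_civita_def metric_compatible_def)

text \<open>
  Koszul's formula. The bracket of constant fields vanishes, so the connection is symmetric on them,
  and the cyclic combination of the three compatibility identities isolates one inner product.
\<close>

lemma connection_const:
  assumes r: "r \<in> simplex_interior" and a: "a \<in> tangent_space" and b: "b \<in> tangent_space"
  shows "D (\<lambda>_. a) (\<lambda>_. b) r = christoffel r a b"
proof (rule metric_nondegenerate[OF r])
  show "D (\<lambda>_. a) (\<lambda>_. b) r \<in> tangent_space"
    using connection_field[OF const_vector_field[OF a] const_vector_field[OF b]] r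
    by (simp add: vector_fields_def)
  show "christoffel r a b \<in> tangent_space"
    by (rule christoffel_tangent)
  fix c :: "real ^ 'n"
  assume c: "c \<in> tangent_space"
  let ?g = "wasserstein_metric E \<omega> r"
  let ?D = "\<lambda>x y. D (\<lambda>_. x) (\<lambda>_. y) r"
  have g_sym: "?g x y = ?g y x" for x y
    by (simp add: wasserstein_metric_def inner_commute[of y] pseudo_inverse_self_adjoint[OF r])
  have D_sym: "?D x y = ?D y x" if "x \<in> tangent_space" "y \<in> tangent_space" for x y
  proof -
    have "?D x y - ?D y x = lie_bracket (\<lambda>_. x) (\<lambda>_. y) r"
      using lc r that by (simp add: levi_civita_def torsion_free_def const_vector_field)
    then show ?thesis
      by (simp add: lie_bracket_const)
  qed
  have compat: "- ((P r *v y) \<bullet> (L x *v (P r *v z))) = ?g (?D x y) z + ?g y (?D x z)"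
    if "x \<in> tangent_space" "y \<in> tangent_space" "z \<in> tangent_space" for x y z
    using connection_compatible[of "\<lambda>_. x" "\<lambda>_. y" "\<lambda>_. z", OF _ _ _ r] metric_derivative[OF r that]
    by (simp add: const_vector_field that)
  have "2 * ?g (?D a b) c = 2 * ?g (christoffel r a b) c"
    unfolding metric_christoffel[OF r c]
    using compat[OF a b c] compat[OF b a c] compat[OF c a b]
      D_sym[OF b a] D_sym[OF c a] D_sym[OF c b]
    by (simp add: g_sym[of a] g_sym[of b])
  then show "?g (?D a b) c = ?g (christoffel r a b) c"
    by simp
qed

text \<open>
  By metric compatibility, the second covariant derivative paired with \<open>d\<close> is the derivative along
  \<open>a\<close> of the inner product of the
  covariant derivative of \<open>c\<close> along \<open>b\<close> with \<open>d\<close>, minus a product of two Christoffel terms. That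
  inner product is known at every point of the simplex, as three energies, and not only at \<open>r\<close>;
  this is what makes it differentiable explicitly.
\<close>

lemma metric_second_covariant_derivative:
  assumes r: "r \<in> simplex_interior" and a: "a \<in> tangent_space" and b: "b \<in> tangent_space"
    and c: "c \<in> tangent_space" and d: "d \<in> tangent_space"
  defines "A \<equiv> \<lambda>x y. L x *v (P r *v y)"
  defines "ip \<equiv> \<lambda>x y. x \<bullet> (P r *v y)"
  shows "2 * wasserstein_metric E \<omega> r (D (\<lambda>_. a) (D (\<lambda>_. b) (\<lambda>_. c)) r) d =
     ip (A a c) (A b d) + ip (A b c) (A a d) + ip (A a b) (A c d) + ip (A c b) (A a d)
     - ip (A a b) (A d c) - ip (A d b) (A a c)
     - 2 * ip (christoffel r b c) (christoffel r a d)"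
proof -
  let ?g = "wasserstein_metric E \<omega>"
  let ?e = "\<lambda>x y z t. (P (r + t *\<^sub>R a) *v x) \<bullet> (L y *v (P (r + t *\<^sub>R a) *v z))"
  have "dir_deriv a (\<lambda>r. ?g r (D (\<lambda>_. b) (\<lambda>_. c) r) d) r =
     (1 / 2) *\<^sub>R ((- ip (A a b) (A d c) - ip (A d b) (A a c))
       - (- ip (A a c) (A b d) - ip (A b c) (A a d))
       - (- ip (A a b) (A c d) - ip (A c b) (A a d)))"
  proof (rule dir_deriv_eqI)
    show "\<forall>\<^sub>F t in nhds 0. ?g (r + t *\<^sub>R a) (D (\<lambda>_. b) (\<lambda>_. c) (r + t *\<^sub>R a)) d =
      (1 / 2) *\<^sub>R (?e b d c t - ?e c b d t - ?e b c d t)"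
      using eventually_in_simplex_interior[OF r a]
    proof eventually_elim
      case (elim t)
      show ?case
        using metric_christoffel[OF elim d, of b c] by (simp add: connection_const[OF elim b c])
    qed
    show "((\<lambda>t. (1 / 2) *\<^sub>R (?e b d c t - ?e c b d t - ?e b c d t)) has_vector_derivative
       (1 / 2) *\<^sub>R ((- ip (A a b) (A d c) - ip (A d b) (A a c))
       - (- ip (A a c) (A b d) - ip (A b c) (A a d))
       - (- ip (A a b) (A c d) - ip (A c b) (A a d)))) (at 0)"
      unfolding A_def ip_def
      by (intro bounded_linear.has_vector_derivative[OF bounded_linear_scaleR_right]
            has_vector_derivative_diff energy_derivative r a b c d)
  qed
  moreover have "dir_deriv a (\<lambda>r. ?g r (D (\<lambda>_. b) (\<lambda>_. c) r) d) r =
      ?g r (D (\<lambda>_. a) (D (\<lambda>_. b) (\<lambda>_. c)) r) d + ip (christoffel r b c) (christoffel r a d)"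
    using connection_compatible[OF const_vector_field[OF a]
        connection_field[OF const_vector_field[OF b] const_vector_field[OF c]] const_vector_field[OF d] r]
    by (simp add: connection_const r a b c d wasserstein_metric_def ip_def)
  ultimately show ?thesis
    by simp
qed

section \<open>Curvature\<close>

text \<open>
  The formula for arbitrary tangent vectors, before specialising to eigenvectors: here potentials
  take the place of eigenvalue quotients, so both \<open>m\<close> and \<open>n\<close> lack the eigenvalue factors.
  Everything expands into products \<open>\<langle>A, A\<rangle>\<close>, \<open>A\<^sup>T G\<close> and \<open>G\<^sup>T L(r) G\<close>, and the identity is linear in
  these once their symmetries are taken into account.
\<close>

lemma curvature_tensor_potentials:
  assumes r: "r \<in> simplex_interior" and a: "a \<in> tangent_space" and b: "b \<in> tangent_space"
    and c: "c \<in> tangent_space" and d: "d \<in> tangent_space"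
  defines "\<Phi> \<equiv> \<lambda>x. P r *v x"
  defines "m \<equiv> \<lambda>x y. - (L x *v \<Phi> y + L y *v \<Phi> x) + (1 / 2) *\<^sub>R (L r *v grad_prod (\<Phi> x) (\<Phi> y))"
  defines "n \<equiv> \<lambda>x y. L x *v \<Phi> y - L y *v \<Phi> x"
  shows "4 * curvature_tensor (wasserstein_metric E \<omega>) D r a b c d =
     \<Phi> b \<bullet> (L (m a c) *v \<Phi> d) + \<Phi> a \<bullet> (L (m b d) *v \<Phi> c)
     - \<Phi> b \<bullet> (L (m a d) *v \<Phi> c) - \<Phi> a \<bullet> (L (m b c) *v \<Phi> d)
     + 2 * (n a b \<bullet> \<Phi> (n c d)) + n a c \<bullet> \<Phi> (n b d) - n b c \<bullet> \<Phi> (n a d)"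
proof -
  define A where "A = (\<lambda>x y. L x *v \<Phi> y)"
  define G where "G = (\<lambda>x y. grad_prod (\<Phi> x) (\<Phi> y))"
  define ip where "ip = (\<lambda>x y. x \<bullet> \<Phi> y)"
  let ?DD = "\<lambda>x y. wasserstein_metric E \<omega> r (D (\<lambda>_. x) (D (\<lambda>_. y) (\<lambda>_. c)) r) d"
  have ip_sym: "ip x y = ip y x" for x y
    by (simp add: ip_def \<Phi>_def inner_commute[of y] pseudo_inverse_self_adjoint[OF r])
  have G_sym: "G x y = G y x" for x y
    by (simp add: G_def grad_prod_commute)
  have \<Phi>_lin: "\<Phi> (x + y) = \<Phi> x + \<Phi> y" "\<Phi> (x - y) = \<Phi> x - \<Phi> y" "\<Phi> (s *\<^sub>R x) = s *\<^sub>R \<Phi> x" for x y s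
    by (simp_all add: \<Phi>_def matrix_vector_right_distrib matrix_vector_mult_diff_distrib matrix_vector_mult_scaleR)
  have ip_lin: "ip (x + y) z = ip x z + ip y z" "ip (x - y) z = ip x z - ip y z"
    "ip z (x + y) = ip z x + ip z y" "ip z (x - y) = ip z x - ip z y"
    "ip (s *\<^sub>R x) z = s * ip x z" "ip z (s *\<^sub>R x) = s * ip z x" for x y z s
    by (simp_all add: ip_def \<Phi>_lin inner_add_left inner_add_right inner_diff_left inner_diff_right)
  have ip_L: "ip (L r *v x) (A y z) = A y z \<bullet> x" "ip (A y z) (L r *v x) = A y z \<bullet> x"
    "ip (L r *v x) (L r *v y) = x \<bullet> (L r *v y)" for x y z
    using metric_laplacian[OF r laplacian_tangent, of x] ip_sym[of "A y z"]
    by (simp_all add: ip_def A_def \<Phi>_def inner_commute)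
  have christoffel: "christoffel r x y = (1 / 2) *\<^sub>R (L r *v G x y - A x y - A y x)" for x y
    by (simp add: christoffel_def A_def G_def \<Phi>_def)
  have LG: "x \<bullet> (L r *v y) = y \<bullet> (L r *v x)" for x y
    by (metis inner_commute laplacian_self_adjoint)
  have mG: "\<Phi> x \<bullet> (L (m v w) *v \<Phi> y)
      = (1 / 2) * (G x y \<bullet> (L r *v G v w)) - A v w \<bullet> G x y - A w v \<bullet> G x y" for v w x y
  proof -
    have "\<Phi> x \<bullet> (L (m v w) *v \<Phi> y) = m v w \<bullet> G x y"
      by (simp only: inner_laplacian G_def)
    also have "\<dots> = (- (A v w + A w v) + (1 / 2) *\<^sub>R (L r *v G v w)) \<bullet> G x y"
      by (simp only: m_def A_def G_def)
    also have "(- (A v w + A w v) + (1 / 2) *\<^sub>R (L r *v G v w)) \<bullet> G x y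
      = (1 / 2) * (G x y \<bullet> (L r *v G v w)) - A v w \<bullet> G x y - A w v \<bullet> G x y"
      by (simp add: inner_add_left inner_diff_left inner_commute[of "L r *v G v w"])
    finally show ?thesis .
  qed
  have nA: "n x y \<bullet> \<Phi> (n v w) = ip (A x y - A y x) (A v w - A w v)" for x y v w
    by (simp add: n_def A_def ip_def)
  have "curvature_tensor (wasserstein_metric E \<omega>) D r a b c d = ?DD a b - ?DD b a"
  proof -
    have "D (lie_bracket (\<lambda>_. a) (\<lambda>_. b)) (\<lambda>_. c) r = 0"
      using lc affine_connection_zero_left[OF _ const_vector_field[OF c] r]
      by (simp add: lie_bracket_const levi_civita_def)
    then show ?thesis
      by (simp add: curvature_tensor_def curvature_def wasserstein_metric_def inner_diff_left)
  qed
  moreover have DD: "2 * ?DD x y = ip (A x c) (A y d) + ip (A y c) (A x d) + ip (A x y) (A c d)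
       + ip (A c y) (A x d) - ip (A x y) (A d c) - ip (A d y) (A x c)
       - 2 * ip (christoffel r y c) (christoffel r x d)" if "x \<in> tangent_space" "y \<in> tangent_space" for x y
    using metric_second_covariant_derivative[OF r that c d]
    by (simp add: A_def ip_def \<Phi>_def)
  ultimately show ?thesis
    using DD[OF a b] DD[OF b a]
    unfolding mG nA christoffel ip_lin ip_L
    by (simp add: algebra_simps ip_sym LG G_sym)
qed

end

end

theorem proposition7:
  fixes E :: "('n::finite \<times> 'n) set"
    and \<omega> :: "'n \<Rightarrow> 'n \<Rightarrow> real"
    and \<rho> :: "real ^ 'n"
    and D :: "(real ^ 'n \<Rightarrow> real ^ 'n) \<Rightarrow> (real ^ 'n \<Rightarrow> real ^ 'n) \<Rightarrow> real ^ 'n \<Rightarrow> real ^ 'n"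
    and lam :: "nat \<Rightarrow> real"
    and u X :: "nat \<Rightarrow> real ^ 'n"
    and I :: "nat set"
    and L :: "real ^ 'n \<Rightarrow> real ^ 'n ^ 'n"
    and P :: "real ^ 'n ^ 'n"
    and g :: "real ^ 'n \<Rightarrow> real ^ 'n \<Rightarrow> real ^ 'n \<Rightarrow> real"
    and m n :: "nat \<Rightarrow> nat \<Rightarrow> real ^ 'n"
    and R :: "nat \<Rightarrow> nat \<Rightarrow> nat \<Rightarrow> nat \<Rightarrow> real"
    and K Ric :: "nat \<Rightarrow> nat \<Rightarrow> real"
    and S :: real
  assumes graph: "weighted_graph E \<omega>" "connected_graph E"
    and rho: "\<rho> \<in> simplex_interior"
    and I: "I = {1..CARD('n) - 1}"
    and L: "L = laplacian E \<omega>"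
    and P: "P = pseudo_inverse (L \<rho>)"
    and g: "g = wasserstein_metric E \<omega>"
    and connection: "levi_civita g D"
    and eigenvalues: "\<And>i. i \<in> I \<Longrightarrow> lam i > 0"
    and eigenvectors: "\<And>i. i \<in> I \<Longrightarrow> L \<rho> *v u i = lam i *\<^sub>R u i"
    and orthonormal: "\<And>i j. i \<in> I \<Longrightarrow> j \<in> I \<Longrightarrow> u i \<bullet> u j = (if i = j then 1 else 0)"
    and X: "X = (\<lambda>i. sqrt (lam i) *\<^sub>R u i)"
    and m: "m = (\<lambda>a b. - (lam a *\<^sub>R (L (X a) *v X b) + lam b *\<^sub>R (L (X b) *v X a))
                  + (1 / 2) *\<^sub>R (L \<rho> *v edge_prod E (grad \<omega> (X a)) (grad \<omega> (X b))))"
    and n: "n = (\<lambda>a b. lam a *\<^sub>R (L (X a) *v X b) - lam b *\<^sub>R (L (X b) *v X a))"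
    and R: "R = (\<lambda>i j k l. curvature_tensor g D \<rho> (X i) (X j) (X k) (X l))"
    and K: "K = (\<lambda>i j. R i j j i)"
    and Ric: "Ric = (\<lambda>i j. \<Sum>k\<in>I. R i k k j)"
    and S: "S = (\<Sum>i\<in>I. \<Sum>j\<in>I. R i j j i)"
  shows
    "(\<forall>i\<in>I. \<forall>j\<in>I. g \<rho> (X i) (X j) = (if i = j then 1 else 0)) \<and> span (X ` I) = tangent_space \<and>
    (\<forall>i\<in>I. \<forall>j\<in>I. \<forall>k\<in>I. \<forall>l\<in>I.
       R i j k l = 1 / (4 * lam i * lam j * lam k * lam l) *
         (X j \<bullet> (L (m i k) *v X l) + X i \<bullet> (L (m j l) *v X k)
          - X j \<bullet> (L (m i l) *v X k) - X i \<bullet> (L (m j k) *v X l)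
          + 2 * (n i j \<bullet> (P *v n k l)) + n i k \<bullet> (P *v n j l) - n j k \<bullet> (P *v n i l))) \<and>
    (\<forall>i\<in>I. \<forall>j\<in>I.
       K i j = 1 / (4 * (lam i)\<^sup>2 * (lam j)\<^sup>2) *
         (X j \<bullet> (L (m i j) *v X i) + X i \<bullet> (L (m j i) *v X j)
          - X j \<bullet> (L (m i i) *v X j) - X i \<bullet> (L (m j j) *v X i)
          - 3 * (n i j \<bullet> (P *v n i j)))) \<and>
    (\<forall>i\<in>I. \<forall>j\<in>I.
       Ric i j = 1 / (4 * lam i * lam j) * (\<Sum>k\<in>I. 1 / (lam k)\<^sup>2 *
         (X k \<bullet> (L (m i k) *v X j) + X i \<bullet> (L (m j k) *v X k)
          - X k \<bullet> (L (m i j) *v X k) - X i \<bullet> (L (m k k) *v X j)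
          - 3 * (n i k \<bullet> (P *v n j k))))) \<and>
    S = (\<Sum>i\<in>I. 1 / (4 * lam i * lam i) * (\<Sum>k\<in>I. 1 / (lam k)\<^sup>2 *
         (X k \<bullet> (L (m i k) *v X i) + X i \<bullet> (L (m i k) *v X k)
          - X k \<bullet> (L (m i i) *v X k) - X i \<bullet> (L (m k k) *v X i)
          - 3 * (n i k \<bullet> (P *v n i k)))))"
proof -
  interpret connected_weighted_graph E \<omega>
    by unfold_locales (fact graph)+
  have L': "L = laplacian E \<omega>" and P': "P = pseudo_inverse (laplacian E \<omega> \<rho>)"
    using L P by simp_all
  have lam0: "lam i > 0" if "i \<in> I" for i
    using eigenvalues that .
  have mv_lin: "(A::real^'n^'n) *v (- x) = - (A *v x)" for A x
    by (simp add: linear_neg[OF matrix_vector_mul_linear])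
  have u_tan: "u i \<in> tangent_space" if "i \<in> I" for i
  proof -
    have "lam i *\<^sub>R u i \<in> tangent_space"
      using laplacian_tangent[of \<rho> "u i"] eigenvectors[OF that] by (simp add: L')
    then show ?thesis
      using lam0[OF that] by (simp add: tangent_space_iff)
  qed
  then have X_tan: "X i \<in> tangent_space" if "i \<in> I" for i
    using that by (simp add: X subspace_scale subspace_tangent_space)
  have PX: "P *v X i = (1 / lam i) *\<^sub>R X i" if "i \<in> I" for i
  proof -
    have "lam i *\<^sub>R (P *v X i) = P *v (L \<rho> *v X i)"
      using eigenvectors[OF that] by (simp add: X matrix_vector_mult_scaleR)
    also have "\<dots> = X i"
      using pseudo_inverse_laplacian_id[OF rho X_tan[OF that]] by (simp add: L' P')
    finally show ?thesis
      using lam0[OF that] by (metis divideR_right divide_inverse_commute inverse_eq_divide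
        less_irrefl mult.right_neutral)
  qed
  have ortho: "g \<rho> (X i) (X j) = (if i = j then 1 else 0)" if "i \<in> I" "j \<in> I" for i j
  proof -
    have "g \<rho> (X i) (X j) = X i \<bullet> (P *v X j)"
      by (simp add: g wasserstein_metric_def P')
    also have "\<dots> = sqrt (lam i) * sqrt (lam j) / lam j * (if i = j then 1 else 0)"
      unfolding PX[OF that(2)] using orthonormal[OF that] by (simp add: X)
    also have "\<dots> = (if i = j then 1 else 0)"
      using lam0[OF that(1)] by auto
    finally show ?thesis .
  qed
  have span: "span (X ` I) = tangent_space"
  proof (rule span_subspace)
    show "X ` I \<subseteq> tangent_space"
      using X_tan by blast
    show "subspace (tangent_space :: (real^'n) set)"
      by (rule subspace_tangent_space)
    have inner_X: "X i \<bullet> X j = (if i = j then lam i else 0)" if "i \<in> I" "j \<in> I" for i j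
      using orthonormal[OF that] lam0[OF that(1)] by (auto simp: X)
    have "independent (X ` I)"
    proof (rule pairwise_orthogonal_independent)
      show "pairwise orthogonal (X ` I)"
        by (auto simp: pairwise_def orthogonal_def inner_X)
      show "0 \<notin> X ` I"
        using inner_X lam0 by (metis imageE inner_zero_left less_irrefl)
    qed
    moreover have "inj_on X I"
      by (rule inj_onI) (metis inner_X lam0 less_irrefl)
    then have "card (X ` I) = CARD('n) - 1"
      by (simp add: card_image I)
    moreover have "dim (tangent_space :: (real^'n) set) = CARD('n) - 1"
      by (rule dim_tangent_space)
    ultimately show "tangent_space \<subseteq> span (X ` I)"
      using \<open>X ` I \<subseteq> tangent_space\<close> by (intro card_ge_dim_independent) simp_all
  qed
  have m_sym: "m a b = m b a" for a b
    using grad_prod_commute by (simp add: m grad_prod_def add.commute)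
  have n_antisym: "n a b = - n b a" for a b
    by (simp add: n)
  have R_formula: "R i j k l = 1 / (4 * lam i * lam j * lam k * lam l) *
         (X j \<bullet> (L (m i k) *v X l) + X i \<bullet> (L (m j l) *v X k)
          - X j \<bullet> (L (m i l) *v X k) - X i \<bullet> (L (m j k) *v X l)
          + 2 * (n i j \<bullet> (P *v n k l)) + n i k \<bullet> (P *v n j l) - n j k \<bullet> (P *v n i l))"
    if ijkl: "i \<in> I" "j \<in> I" "k \<in> I" "l \<in> I" for i j k l
  proof -
    define c where "c = 1 / (lam i * lam j * lam k * lam l)"
    \<comment> \<open>By homogeneity, the eigenvalue factors of \<open>m\<close> and \<open>n\<close> clear the denominators of the potentials.\<close>
    have m': "- (L (X a) *v (P *v X b) + L (X b) *v (P *v X a))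
        + (1 / 2) *\<^sub>R (L \<rho> *v grad_prod (P *v X a) (P *v X b)) = (1 / (lam a * lam b)) *\<^sub>R m a b"
      if "a \<in> I" "b \<in> I" for a b
      using lam0[OF that(1)] lam0[OF that(2)] unfolding PX[OF that(1)] PX[OF that(2)]
      by (simp add: m grad_prod_scaleR grad_prod_def[symmetric] matrix_vector_mult_scaleR scaleR_diff_right scaleR_add_right)
    have n': "L (X a) *v (P *v X b) - L (X b) *v (P *v X a) = (1 / (lam a * lam b)) *\<^sub>R n a b"
      if "a \<in> I" "b \<in> I" for a b
      using lam0[OF that(1)] lam0[OF that(2)] unfolding PX[OF that(1)] PX[OF that(2)]
      by (simp add: n matrix_vector_mult_scaleR scaleR_diff_right)
    note curv = curvature_tensor_potentials[OF connection[unfolded g] rho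
          X_tan[OF ijkl(1)] X_tan[OF ijkl(2)] X_tan[OF ijkl(3)] X_tan[OF ijkl(4)], folded P' L' g]
    have "4 * R i j k l = c *
         (X j \<bullet> (L (m i k) *v X l) + X i \<bullet> (L (m j l) *v X k)
          - X j \<bullet> (L (m i l) *v X k) - X i \<bullet> (L (m j k) *v X l)
          + 2 * (n i j \<bullet> (P *v n k l)) + n i k \<bullet> (P *v n j l) - n j k \<bullet> (P *v n i l))"
      unfolding R curv m'[OF ijkl(1,3)] m'[OF ijkl(2,4)] m'[OF ijkl(1,4)] m'[OF ijkl(2,3)]
        n'[OF ijkl(1,2)] n'[OF ijkl(3,4)] n'[OF ijkl(1,3)] n'[OF ijkl(2,4)] n'[OF ijkl(2,3)]
        n'[OF ijkl(1,4)]
      unfolding PX[OF ijkl(1)] PX[OF ijkl(2)] PX[OF ijkl(3)] PX[OF ijkl(4)] L' laplacian_scaleR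
        matrix_vector_mult_scaleR inner_scaleR_left inner_scaleR_right c_def
      by (simp add: algebra_simps)
    then show ?thesis
      by (simp add: c_def)
  qed
  have n_self: "n a a = 0" for a
    by (simp add: n)
  \<comment> \<open>Antisymmetry turns \<open>2 \<langle>n\<^sub>i\<^sub>k, n\<^sub>k\<^sub>j\<rangle> + \<langle>n\<^sub>i\<^sub>k, n\<^sub>k\<^sub>j\<rangle>\<close> into \<open>-3 \<langle>n\<^sub>i\<^sub>k, n\<^sub>j\<^sub>k\<rangle>\<close>, and \<open>n\<^sub>k\<^sub>k\<close> vanishes.\<close>
  have R_contracted: "R i k k j = 1 / (4 * lam i * lam j) * (1 / (lam k)\<^sup>2 *
         (X k \<bullet> (L (m i k) *v X j) + X i \<bullet> (L (m j k) *v X k)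
          - X k \<bullet> (L (m i j) *v X k) - X i \<bullet> (L (m k k) *v X j)
          - 3 * (n i k \<bullet> (P *v n j k))))" if "i \<in> I" "j \<in> I" "k \<in> I" for i j k
    unfolding R_formula[OF that(1,3,3,2)] m_sym[of k j] n_antisym[of k j] n_self mv_lin
    by (simp add: power2_eq_square mult_ac)
  have K_formula: "K i j = 1 / (4 * (lam i)\<^sup>2 * (lam j)\<^sup>2) *
         (X j \<bullet> (L (m i j) *v X i) + X i \<bullet> (L (m j i) *v X j)
          - X j \<bullet> (L (m i i) *v X j) - X i \<bullet> (L (m j j) *v X i)
          - 3 * (n i j \<bullet> (P *v n i j)))" if "i \<in> I" "j \<in> I" for i j
    unfolding K R_contracted[OF that(1,1,2)] m_sym[of j i]
    by (simp add: power2_eq_square mult_ac)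
  have Ric_formula: "Ric i j = 1 / (4 * lam i * lam j) * (\<Sum>k\<in>I. 1 / (lam k)\<^sup>2 *
         (X k \<bullet> (L (m i k) *v X j) + X i \<bullet> (L (m j k) *v X k)
          - X k \<bullet> (L (m i j) *v X k) - X i \<bullet> (L (m k k) *v X j)
          - 3 * (n i k \<bullet> (P *v n j k))))" if "i \<in> I" "j \<in> I" for i j
    unfolding Ric sum_distrib_left by (rule sum.cong[OF refl]) (rule R_contracted[OF that])
  have S_formula: "S = (\<Sum>i\<in>I. 1 / (4 * lam i * lam i) * (\<Sum>k\<in>I. 1 / (lam k)\<^sup>2 *
         (X k \<bullet> (L (m i k) *v X i) + X i \<bullet> (L (m i k) *v X k)
          - X k \<bullet> (L (m i i) *v X k) - X i \<bullet> (L (m k k) *v X i)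
          - 3 * (n i k \<bullet> (P *v n i k)))))"
  proof -
    have "S = (\<Sum>i\<in>I. Ric i i)"
      by (simp only: S Ric)
    then show ?thesis
      by (simp only: Ric_formula cong: sum.cong)
  qed
  show ?thesis
    by (intro conjI ballI; (rule ortho span R_formula K_formula Ric_formula S_formula)?; assumption?)
qed

end
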